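(* Let $G$ be a connected bipartite cubic graph of order $n$. Then $G$ has an IPD and $\rho(G) \le \frac{n}{3}$.
   Context: All graphs are finite and simple; cubic means $3$-regular. The order of a path is its number of vertices. A path $P$ in $G$ is induced if the subgraph of $G$ induced on $V(P)$ is exactly $P$. An IPD of $G$ is a partition of $V(G)$ into sets $V_1,\dots,V_t$ such that each $G[V_i]$ is a path of order at least $2$; its size is $t$. $\rho(G)$ denotes the smallest size of an IPD of $G$. *)

theory Defs
  imports Main
begin

definition simple_graph :: "'a set \<Rightarrow> ('a \<Rightarrow> 'a \<Rightarrow> bool) \<Rightarrow> bool" where
  "simple_graph V E \<longleftrightarrow> finite V \<and> (\<forall>u v. E u v \<longrightarrow> u \<in> V \<and> v \<in> V)
     \<and> (\<forall>u v. E u v \<longrightarrow> E v u) \<and> (\<forall>v. \<not> E v v)"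

definition degree :: "'a set \<Rightarrow> ('a \<Rightarrow> 'a \<Rightarrow> bool) \<Rightarrow> 'a \<Rightarrow> nat" where
  "degree V E v = card {u \<in> V. E v u}"

definition cubic :: "'a set \<Rightarrow> ('a \<Rightarrow> 'a \<Rightarrow> bool) \<Rightarrow> bool" where
  "cubic V E \<longleftrightarrow> (\<forall>v\<in>V. degree V E v = 3)"

definition is_walk :: "('a \<Rightarrow> 'a \<Rightarrow> bool) \<Rightarrow> 'a list \<Rightarrow> bool" where
  "is_walk E xs \<longleftrightarrow> xs \<noteq> [] \<and> (\<forall>i. Suc i < length xs \<longrightarrow> E (xs ! i) (xs ! Suc i))"

definition connected_graph :: "'a set \<Rightarrow> ('a \<Rightarrow> 'a \<Rightarrow> bool) \<Rightarrow> bool" where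
  "connected_graph V E \<longleftrightarrow> V \<noteq> {} \<and>
     (\<forall>u\<in>V. \<forall>v\<in>V. \<exists>xs. is_walk E xs \<and> hd xs = u \<and> last xs = v)"

definition bipartite :: "'a set \<Rightarrow> ('a \<Rightarrow> 'a \<Rightarrow> bool) \<Rightarrow> bool" where
  "bipartite V E \<longleftrightarrow> (\<exists>A B. A \<union> B = V \<and> A \<inter> B = {} \<and>
     (\<forall>u v. E u v \<longrightarrow> (u \<in> A \<and> v \<in> B) \<or> (u \<in> B \<and> v \<in> A)))"

definition induced_path :: "('a \<Rightarrow> 'a \<Rightarrow> bool) \<Rightarrow> 'a set \<Rightarrow> bool" where
  "induced_path E S \<longleftrightarrow> (\<exists>xs. distinct xs \<and> set xs = S \<and>
     (\<forall>i<length xs. \<forall>j<length xs. E (xs ! i) (xs ! j) \<longleftrightarrow> (i = Suc j \<or> j = Suc i)))"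

definition is_IPD :: "'a set \<Rightarrow> ('a \<Rightarrow> 'a \<Rightarrow> bool) \<Rightarrow> 'a set set \<Rightarrow> bool" where
  "is_IPD V E P \<longleftrightarrow> \<Union>P = V \<and> (\<forall>X\<in>P. \<forall>Y\<in>P. X \<noteq> Y \<longrightarrow> X \<inter> Y = {}) \<and>
     (\<forall>X\<in>P. induced_path E X \<and> card X \<ge> 2)"

definition has_IPD :: "'a set \<Rightarrow> ('a \<Rightarrow> 'a \<Rightarrow> bool) \<Rightarrow> bool" where
  "has_IPD V E \<longleftrightarrow> (\<exists>P. is_IPD V E P)"

definition rho :: "'a set \<Rightarrow> ('a \<Rightarrow> 'a \<Rightarrow> bool) \<Rightarrow> nat" where
  "rho V E = (LEAST t. \<exists>P. is_IPD V E P \<and> card P = t)"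

end

theory Submission
  imports Defs
begin

text \<open>In a bipartite graph every path of order 3 is induced, and a path of order 4 is induced unless
  its ends are adjacent. A cycle \<open>c\<^sub>0 c\<^sub>1 \<dots>\<close> of even length \<open>L \<ge> 8\<close> in a cubic graph cannot have both
  chords \<open>c\<^sub>i c\<^sub>i\<^sub>+\<^sub>3\<close> and \<open>c\<^sub>i\<^sub>+\<^sub>3 c\<^sub>i\<^sub>+\<^sub>6\<close>, and this leaves enough induced windows to cut it into paths of
  order 3 together with one induced path of order 4 (\<open>L \<equiv> 1\<close> modulo 3), respectively one of order 5 or
  two of order 4 (\<open>L \<equiv> 2\<close>). Hence it suffices to find a 2-factor without 4-cycles.

  Contract every 4-cycle that is disjoint from all other 4-cycles to a single edge. The result is
  again 3-regular and bipartite, so it has a perfect matching by Hall's theorem; the matching lifts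
  to the graph so that it uses an edge of each of these 4-cycles, and none of them is a component of
  the complementary 2-factor. Among the 2-factors with this property take one with the fewest
  cycles. If a component \<open>D\<close> were a 4-cycle, another 4-cycle \<open>v\<^sub>1 v\<^sub>2 v\<^sub>3 v\<^sub>4\<close> would meet it, say with
  \<open>v\<^sub>1 \<notin> D\<close> and \<open>v\<^sub>2 \<in> D\<close>. As degrees are 3, the 2-factor contains \<open>v\<^sub>2 v\<^sub>3\<close> and \<open>v\<^sub>1 v\<^sub>4\<close>, and
  exchanging these for \<open>v\<^sub>1 v\<^sub>2\<close> and \<open>v\<^sub>3 v\<^sub>4\<close> merges two cycles into one.\<close>

section \<open>Matchings in regular bipartite graphs\<close>

text \<open>Induction on proper subsets of \<open>X\<close>. If every nonempty proper subset has
  more neighbours than elements, an arbitrary choice for one \<open>x\<close> leaves Hall's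
  condition intact. Otherwise a tight \<open>S\<close> splits the problem into \<open>S\<close> and
  \<open>X - S\<close>, the latter with the neighbours of \<open>S\<close> deleted.\<close>

lemma hall_marriage:
  assumes "finite X" and "\<And>x. x \<in> X \<Longrightarrow> finite (N x)"
    and "\<And>S. S \<subseteq> X \<Longrightarrow> card S \<le> card (\<Union> (N ` S))"
  shows "\<exists>f. inj_on f X \<and> (\<forall>x\<in>X. f x \<in> N x)"
  using assms
proof (induction X arbitrary: N rule: finite_psubset_induct)
  case (psubset X)
  note fin = psubset.prems(1) and hall = psubset.prems(2)
  have finU: "finite (\<Union> (N ` S))" if "S \<subseteq> X" for S
    using that fin finite_subset[OF _ psubset.hyps(1)] by blast
  consider "X = {}" | "X \<noteq> {}" "\<And>S. S \<subset> X \<Longrightarrow> S \<noteq> {} \<Longrightarrow> card S < card (\<Union> (N ` S))"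
    | S where "S \<subset> X" "S \<noteq> {}" "card (\<Union> (N ` S)) = card S"
    using hall by (metis le_neq_implies_less psubset_imp_subset)
  then show ?case
  proof cases
    case 1
    then show ?thesis by simp
  next
    case 2
    then obtain x where x: "x \<in> X" by blast
    have "card {x} \<le> card (N x)" using hall[of "{x}"] x by simp
    then obtain y where y: "y \<in> N x" by fastforce
    have "\<exists>f. inj_on f (X - {x}) \<and> (\<forall>z\<in>X - {x}. f z \<in> N z - {y})"
    proof (rule psubset.IH)
      show "X - {x} \<subset> X" using x by blast
      show "finite (N z - {y})" if "z \<in> X - {x}" for z using fin that by blast
      fix S assume S: "S \<subseteq> X - {x}"
      show "card S \<le> card (\<Union>z\<in>S. N z - {y})"
      proof (cases "S = {}")
        case False
        have "S \<subset> X" using S x by blast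
        then have "card S < card (\<Union> (N ` S))" using 2(2) False by blast
        moreover have "(\<Union>z\<in>S. N z - {y}) = \<Union> (N ` S) - {y}" by blast
        moreover have "card (\<Union> (N ` S)) \<le> Suc (card (\<Union> (N ` S) - {y}))"
          by (metis card_Suc_Diff1 card_Diff_singleton_if finU[OF psubset_imp_subset[OF \<open>S \<subset> X\<close>]]
              le_refl nat_le_linear not_less_eq_eq)
        ultimately show ?thesis by simp
      qed simp
    qed
    then obtain f where f: "inj_on f (X - {x})" "\<forall>z\<in>X - {x}. f z \<in> N z - {y}" by blast
    have "inj_on (f(x := y)) X \<and> (\<forall>z\<in>X. (f(x := y)) z \<in> N z)"
      using f y unfolding inj_on_def by auto
    then show ?thesis by blast
  next
    case 3
    then have SX: "S \<subseteq> X" by blast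
    let ?U = "\<Union> (N ` S)"
    have "\<exists>f. inj_on f S \<and> (\<forall>z\<in>S. f z \<in> N z)"
      by (rule psubset.IH) (use 3 fin hall in auto)
    then obtain f where f: "inj_on f S" "\<forall>z\<in>S. f z \<in> N z" by blast
    have "\<exists>g. inj_on g (X - S) \<and> (\<forall>z\<in>X - S. g z \<in> N z - ?U)"
    proof (rule psubset.IH)
      show "X - S \<subset> X" using 3 by blast
      show "finite (N z - ?U)" if "z \<in> X - S" for z using fin that by blast
      fix T assume T: "T \<subseteq> X - S"
      have fins: "finite S" "finite T" using SX T psubset.hyps(1) finite_subset by blast+
      \<comment> \<open>Hall's condition for \<open>S \<union> T\<close> becomes the condition for
        \<open>T\<close> once the tight equality for \<open>S\<close> is cancelled.\<close>
      have "card S + card T = card (S \<union> T)"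
        using T fins by (subst card_Un_disjoint) auto
      also have "\<dots> \<le> card (\<Union> (N ` (S \<union> T)))" using hall[of "S \<union> T"] SX T by blast
      also have "\<Union> (N ` (S \<union> T)) = ?U \<union> (\<Union>z\<in>T. N z - ?U)" by blast
      also have "card \<dots> \<le> card ?U + card (\<Union>z\<in>T. N z - ?U)" by (rule card_Un_le)
      finally show "card T \<le> card (\<Union>z\<in>T. N z - ?U)" using 3 by simp
    qed
    then obtain g where g: "inj_on g (X - S)" "\<forall>z\<in>X - S. g z \<in> N z - ?U" by blast
    let ?h = "\<lambda>z. if z \<in> S then f z else g z"
    have "?h z \<in> N z" if "z \<in> X" for z using f g that by auto
    moreover have "inj_on ?h X"
    proof (rule inj_onI)
      fix u v assume uv: "u \<in> X" "v \<in> X" "?h u = ?h v"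
      have "u \<in> S \<longleftrightarrow> v \<in> S"
        using uv f(2) g(2) by (auto split: if_splits) (metis DiffE DiffI UN_I)+
      then show "u = v" using uv f(1) g(1) by (auto simp: inj_on_def split: if_splits)
    qed
    ultimately show ?thesis by blast
  qed
qed

text \<open>The weights are edge multiplicities, since contracting can create parallel edges. The
  weight \<open>k * card S\<close> leaving \<open>S\<close> all arrives at neighbours of
  \<open>S\<close>, each absorbing at most \<open>k\<close>; this is Hall's condition. Counting the
  total weight from both sides makes the injection onto.\<close>

lemma regular_weights_matching:
  fixes w :: "'a \<Rightarrow> 'b \<Rightarrow> nat"
  assumes fin: "finite A" "finite B" and "k > 0"
    and row: "\<And>a. a \<in> A \<Longrightarrow> (\<Sum>b\<in>B. w a b) = k"
    and col: "\<And>b. b \<in> B \<Longrightarrow> (\<Sum>a\<in>A. w a b) = k"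
  shows "\<exists>f. bij_betw f A B \<and> (\<forall>a\<in>A. w a (f a) > 0)"
proof -
  define N where "N a = {b \<in> B. w a b > 0}" for a
  have "\<exists>f. inj_on f A \<and> (\<forall>a\<in>A. f a \<in> N a)"
  proof (rule hall_marriage)
    show "finite A" by fact
    show "finite (N a)" for a using fin by (simp add: N_def)
    fix S assume S: "S \<subseteq> A"
    then have finS: "finite S" using fin finite_subset by blast
    have NB: "\<Union> (N ` S) \<subseteq> B" by (auto simp: N_def)
    have "card S * k = (\<Sum>a\<in>S. \<Sum>b\<in>B. w a b)" using row S by (simp add: subset_iff)
    also have "\<dots> = (\<Sum>a\<in>S. \<Sum>b\<in>\<Union> (N ` S). w a b)"
      by (intro sum.cong[OF refl] sum.mono_neutral_right) (use fin NB in \<open>auto simp: N_def\<close>)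
    also have "\<dots> = (\<Sum>b\<in>\<Union> (N ` S). \<Sum>a\<in>S. w a b)" by (rule sum.swap)
    also have "\<dots> \<le> (\<Sum>b\<in>\<Union> (N ` S). \<Sum>a\<in>A. w a b)"
      by (intro sum_mono sum_mono2) (use fin S in auto)
    also have "\<dots> = (\<Sum>b\<in>\<Union> (N ` S). k)"
      by (rule sum.cong[OF refl]) (use NB col in blast)
    also have "\<dots> = card (\<Union> (N ` S)) * k" by simp
    finally show "card S \<le> card (\<Union> (N ` S))" using \<open>k > 0\<close> by simp
  qed
  then obtain f where f: "inj_on f A" "\<forall>a\<in>A. f a \<in> N a" by blast
  have "card A * k = (\<Sum>a\<in>A. \<Sum>b\<in>B. w a b)" using row by simp
  also have "\<dots> = (\<Sum>b\<in>B. \<Sum>a\<in>A. w a b)" by (rule sum.swap)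
  also have "\<dots> = card B * k" using col by simp
  finally have "card A = card B" using \<open>k > 0\<close> by simp
  then have "f ` A = B"
    using f fin by (intro card_subset_eq) (auto simp: card_image N_def)
  then show ?thesis using f by (auto simp: bij_betw_def N_def)
qed

text \<open>Weight exactly 1 on the four edges is what keeps 3-regularity: each of the four vertices
  has one unit of weight left outside the copy, so a merged vertex has 1 + 1 outside plus 1 for the
  contracted edge.\<close>

definition k22 :: "'a set \<Rightarrow> 'b set \<Rightarrow> ('a \<Rightarrow> 'b \<Rightarrow> nat) \<Rightarrow> 'a \<times> 'a \<times> 'b \<times> 'b \<Rightarrow> bool" where
  "k22 A B w = (\<lambda>(p, q, r, s). p \<in> A \<and> q \<in> A \<and> p \<noteq> q \<and> r \<in> B \<and> s \<in> B \<and> r \<noteq> s \<and>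
     w p r = 1 \<and> w p s = 1 \<and> w q r = 1 \<and> w q s = 1)"

text \<open>Each copy of \<open>K\<^sub>2\<^sub>,\<^sub>2\<close> is contracted to a single edge of weight 1; this keeps the weights
  3-regular, and a perfect matching of the contraction lifts to one that uses an edge of the copy.\<close>

lemma cubic_weights_matching:
  fixes w :: "'a \<Rightarrow> 'b \<Rightarrow> nat" and F :: "('a \<times> 'a \<times> 'b \<times> 'b) set"
  assumes "finite F" "finite A" "finite B"
    and "\<And>a. a \<in> A \<Longrightarrow> (\<Sum>b\<in>B. w a b) = 3"
    and "\<And>b. b \<in> B \<Longrightarrow> (\<Sum>a\<in>A. w a b) = 3"
    and "\<And>t. t \<in> F \<Longrightarrow> k22 A B w t"
    and "\<And>p q r s p' q' r' s'. (p, q, r, s) \<in> F \<Longrightarrow> (p', q', r', s') \<in> F \<Longrightarrow>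
      (p, q, r, s) \<noteq> (p', q', r', s') \<Longrightarrow> {p, q} \<inter> {p', q'} = {} \<and> {r, s} \<inter> {r', s'} = {}"
  shows "\<exists>f. bij_betw f A B \<and> (\<forall>a\<in>A. w a (f a) > 0) \<and>
    (\<forall>(p, q, r, s)\<in>F. f p \<in> {r, s} \<or> f q \<in> {r, s})"
  using assms
proof (induction F arbitrary: A B w rule: finite_induct)
  case empty
  then show ?case using regular_weights_matching[of A B 3 w] by auto
next
  case (insert t F)
  obtain p q r s where t: "t = (p, q, r, s)" by (cases t)
  note row = insert.prems(3) and col = insert.prems(4) and disj = insert.prems(6)
  have "k22 A B w (p, q, r, s)" using insert.prems(5) t by blast
  then have pq: "p \<in> A" "q \<in> A" "p \<noteq> q" and rs: "r \<in> B" "s \<in> B" "r \<noteq> s"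
    and w1: "w p r = 1" "w p s = 1" "w q r = 1" "w q s = 1"
    by (auto simp: k22_def)
  \<comment> \<open>Now \<open>p\<close> stands for the merged pair \<open>p\<close>,
    \<open>q\<close>, and \<open>r\<close> for the merged pair \<open>r\<close>, \<open>s\<close>.
    Weights are added up, except that the four edges of the copy become one edge \<open>p r\<close>
    of weight 1.\<close>
  define w' where "w' a b = (if a = p \<and> b = r then 1 else if a = p then w p b + w q b
    else if b = r then w a r + w a s else w a b)" for a b
  let ?A = "A - {q}" and ?B = "B - {s}"
  have fin: "finite A" "finite B" by fact+
  have B_split: "sum g B = g r + (g s + sum g (B - {s} - {r}))" for g :: "'b \<Rightarrow> nat"
  proof -
    have "sum g B = g s + sum g (B - {s})" using fin rs by (intro sum.remove) auto
    also have "sum g (B - {s}) = g r + sum g (B - {s} - {r})"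
      using fin rs by (intro sum.remove) auto
    finally show ?thesis by simp
  qed
  have A_split: "sum g A = g p + (g q + sum g (A - {q} - {p}))" for g :: "'a \<Rightarrow> nat"
  proof -
    have "sum g A = g q + sum g (A - {q})" using fin pq by (intro sum.remove) auto
    also have "sum g (A - {q}) = g p + sum g (A - {q} - {p})"
      using fin pq by (intro sum.remove) auto
    finally show ?thesis by simp
  qed
  have "\<exists>f. bij_betw f ?A ?B \<and> (\<forall>a\<in>?A. w' a (f a) > 0) \<and>
    (\<forall>(p, q, r, s)\<in>F. f p \<in> {r, s} \<or> f q \<in> {r, s})"
  proof (rule insert.IH)
    show "finite ?A" "finite ?B" using fin by auto
    show "(\<Sum>b\<in>?B. w' a b) = 3" if a: "a \<in> ?A" for a
    proof -
      have "(\<Sum>b\<in>?B. w' a b) = w' a r + (\<Sum>b\<in>?B - {r}. w' a b)"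
        using fin rs by (intro sum.remove) auto
      also have "\<dots> = 3"
      proof (cases "a = p")
        case True
        have "(\<Sum>b\<in>?B - {r}. w' a b) = (\<Sum>b\<in>?B - {r}. w p b) + (\<Sum>b\<in>?B - {r}. w q b)"
          unfolding sum.distrib[symmetric] by (rule sum.cong) (auto simp: w'_def True)
        then show ?thesis
          using row[OF pq(1)] row[OF pq(2)] w1 True by (simp add: B_split w'_def)
      next
        case False
        have "(\<Sum>b\<in>?B - {r}. w' a b) = (\<Sum>b\<in>?B - {r}. w a b)"
          by (rule sum.cong) (auto simp: w'_def False)
        then show ?thesis using row[of a] a False by (simp add: B_split w'_def)
      qed
      finally show ?thesis .
    qed
    show "(\<Sum>a\<in>?A. w' a b) = 3" if b: "b \<in> ?B" for b
    proof -
      have "(\<Sum>a\<in>?A. w' a b) = w' p b + (\<Sum>a\<in>?A - {p}. w' a b)"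
        using fin pq by (intro sum.remove) auto
      also have "\<dots> = 3"
      proof (cases "b = r")
        case True
        have "(\<Sum>a\<in>?A - {p}. w' a b) = (\<Sum>a\<in>?A - {p}. w a r) + (\<Sum>a\<in>?A - {p}. w a s)"
          unfolding sum.distrib[symmetric] by (rule sum.cong) (auto simp: w'_def True)
        then show ?thesis
          using col[OF rs(1)] col[OF rs(2)] w1 True by (simp add: A_split w'_def)
      next
        case False
        have "(\<Sum>a\<in>?A - {p}. w' a b) = (\<Sum>a\<in>?A - {p}. w a b)"
          by (rule sum.cong) (auto simp: w'_def False)
        then show ?thesis using col[of b] b False by (simp add: A_split w'_def)
      qed
      finally show ?thesis .
    qed
    \<comment> \<open>The other copies avoid \<open>p\<close>, \<open>q\<close>, \<open>r\<close>
      and \<open>s\<close>, so \<open>w'\<close> agrees with \<open>w\<close> on them.\<close>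
    show "k22 ?A ?B w' u" if u: "u \<in> F" for u
    proof -
      obtain p' q' r' s' where u': "u = (p', q', r', s')" by (cases u)
      have "(p, q, r, s) \<noteq> (p', q', r', s')" using insert.hyps t u u' by auto
      then have "{p, q} \<inter> {p', q'} = {} \<and> {r, s} \<inter> {r', s'} = {}"
        using disj[of p q r s p' q' r' s'] t u u' by blast
      moreover have "k22 A B w (p', q', r', s')" using insert.prems(5) u u' by blast
      ultimately show ?thesis by (auto simp: u' k22_def w'_def)
    qed
    show "{p, q} \<inter> {p', q'} = {} \<and> {r, s} \<inter> {r', s'} = {}"
      if "(p, q, r, s) \<in> F" "(p', q', r', s') \<in> F" "(p, q, r, s) \<noteq> (p', q', r', s')"
      for p q r s p' q' r' s'
      using disj that by blast
  qed
  then obtain f where f: "bij_betw f ?A ?B" "\<forall>a\<in>?A. w' a (f a) > 0"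
    and "\<forall>(p, q, r, s)\<in>F. f p \<in> {r, s} \<or> f q \<in> {r, s}" by blast
  then have fF: "f p \<in> {r, s} \<or> f q \<in> {r, s}" if "(p, q, r, s) \<in> F" for p q r s
    using that by fast
  have fB: "f a \<in> B" "f a \<noteq> s" if "a \<in> A" "a \<noteq> q" for a
    using f(1) that by (auto simp: bij_betw_def)
  have inj: "a = a'" if "f a = f a'" "a \<in> A" "a \<noteq> q" "a' \<in> A" "a' \<noteq> q" for a a'
    using f(1) that by (auto simp: bij_betw_def inj_on_def)
  have surj: "\<exists>a\<in>A - {q}. b = f a" if "b \<in> B" "b \<noteq> s" for b
    using f(1) that by (auto simp: bij_betw_def image_iff)
  have F_disj: "p' \<notin> {p, q} \<and> q' \<notin> {p, q} \<and> r' \<notin> {r, s} \<and> s' \<notin> {r, s} \<and> p' \<in> A \<and> q' \<in> A"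
    if "(p', q', r', s') \<in> F" for p' q' r' s'
  proof -
    have "(p, q, r, s) \<noteq> (p', q', r', s')" using insert.hyps t that by auto
    then have "{p, q} \<inter> {p', q'} = {} \<and> {r, s} \<inter> {r', s'} = {}"
      using disj[of p q r s p' q' r' s'] t that by blast
    moreover have "k22 A B w (p', q', r', s')" using insert.prems(5) that by blast
    ultimately show ?thesis by (auto simp: k22_def)
  qed
  show ?case
  proof (cases "f p = r")
    case True
    \<comment> \<open>The contracted edge is matched, so it is replaced by the two disjoint edges
      \<open>p r\<close> and \<open>q s\<close>. All other matched edges avoid \<open>p\<close> and
      \<open>r\<close>, where \<open>w'\<close> equals \<open>w\<close>.\<close>
    let ?g = "f(q := s)"
    have "inj_on ?g A" using inj fB by (auto simp: inj_on_def)
    moreover have "?g ` A = B"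
    proof
      show "?g ` A \<subseteq> B" using fB rs by auto
      show "B \<subseteq> ?g ` A" using surj pq by (auto simp: image_iff)
    qed
    moreover have "w a (?g a) > 0" if "a \<in> A" for a
    proof (cases "a \<in> {p, q}")
      case True
      then show ?thesis using w1 pq \<open>f p = r\<close> by auto
    next
      case False
      then have "f a \<noteq> r" using inj[of a p] that pq True by auto
      moreover have "w' a (f a) > 0" using f(2) that False by blast
      ultimately show ?thesis using False by (auto simp: w'_def)
    qed
    moreover have "?g p' \<in> {r', s'} \<or> ?g q' \<in> {r', s'}" if F: "(p', q', r', s') \<in> F" for p' q' r' s'
      using fF[OF F] F_disj[OF F] by auto
    moreover have "?g p \<in> {r, s} \<or> ?g q \<in> {r, s}" by simp
    ultimately show ?thesis unfolding t bij_betw_def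
      by (intro exI[of _ ?g] conjI) (blast, blast, blast, (intro ballI, clarify, blast))
  next
    case False
    obtain a where a: "a \<in> A" "a \<noteq> q" "f a = r" using surj[of r] rs by auto
    have "a \<noteq> p" using a False by auto
    have "w' p (f p) > 0" "w' a (f a) > 0" using f(2) pq a by auto
    then have pos: "w p (f p) > 0 \<or> w q (f p) > 0" "w a r > 0 \<or> w a s > 0"
      using False a \<open>a \<noteq> p\<close> by (auto simp: w'_def)
    \<comment> \<open>The contracted edge is not matched. The matched edge at the merged vertex
      \<open>p\<close> really starts at one vertex \<open>x\<close> of the pair, and the one at
      \<open>r\<close> really ends at some \<open>y\<close>. The leftover vertices \<open>x'\<close>
      and \<open>y'\<close> are joined by an edge of the copy, which completes the matching.\<close>
    obtain x x' where x: "x = p \<and> x' = q \<or> x = q \<and> x' = p" "w x (f p) > 0"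
      using pos(1) by blast
    obtain y y' where y: "y = r \<and> y' = s \<or> y = s \<and> y' = r" "w a y > 0"
      using pos(2) by blast
    define g where "g = f(x := f p, a := y, x' := y')"
    have xa: "x \<noteq> a" "x' \<noteq> a" "x \<in> A" "x' \<in> A" using x a pq \<open>a \<noteq> p\<close> by auto
    have gx: "g x = f p" "g x' = y'" "g a = y" unfolding g_def using x xa pq by auto
    have go: "g z = f z" if "z \<notin> {p, q, a}" for z unfolding g_def using x that by auto
    have A_eq: "A = {x, x', a} \<union> (A - {p, q, a})" using xa a x pq by auto
    have im: "g ` A = {f p, y', y} \<union> f ` (A - {p, q, a})"
    proof -
      have "g ` A = g ` {x, x', a} \<union> g ` (A - {p, q, a})" using A_eq image_Un by metis
      also have "g ` (A - {p, q, a}) = f ` (A - {p, q, a})" by (rule image_cong) (auto intro: go)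
      finally show ?thesis by (simp add: gx)
    qed
    have "g ` A = B"
    proof
      show "g ` A \<subseteq> B" unfolding im using fB pq rs y by auto
      show "B \<subseteq> g ` A"
      proof
        fix b assume "b \<in> B"
        show "b \<in> g ` A"
        proof (cases "b \<in> {r, s}")
          case True
          then show ?thesis unfolding im using y by auto
        next
          case False
          then show ?thesis unfolding im using surj[of b] \<open>b \<in> B\<close> a by auto
        qed
      qed
    qed
    moreover have "card B = card A"
    proof -
      have "card ?A = card ?B" using f(1) by (rule bij_betw_same_card)
      then show ?thesis using pq rs fin by (metis card_Suc_Diff1)
    qed
    ultimately have "bij_betw g A B"
      using fin by (metis bij_betw_def eq_card_imp_inj_on)
    moreover have "w z (g z) > 0" if z: "z \<in> A" for z
    proof -
      consider "z = x" | "z = x'" | "z = a" | "z \<in> A - {p, q, a}"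
        using z x by (metis Diff_iff insertE singletonD)
      then show ?thesis
      proof cases
        case 2
        have "x' \<in> {p, q}" "y' \<in> {r, s}" using x y by auto
        then show ?thesis using 2 gx w1 by auto
      next
        case 4
        then have "f z \<noteq> r" using inj[of z a] a by auto
        moreover have "w' z (f z) > 0" using f(2) 4 by auto
        ultimately show ?thesis using 4 go[of z] by (auto simp: w'_def)
      qed (use gx x y in auto)
    qed
    moreover have "g p' \<in> {r', s'} \<or> g q' \<in> {r', s'}" if F: "(p', q', r', s') \<in> F" for p' q' r' s'
    proof -
      have "g z \<in> {r', s'}" if "z \<in> {p', q'}" "f z \<in> {r', s'}" for z
        using that F_disj[OF F] go[of z] a by auto
      then show ?thesis using fF[OF F] by blast
    qed
    moreover have "g p \<in> {r, s} \<or> g q \<in> {r, s}"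
    proof -
      have "x' \<in> {p, q}" "y' \<in> {r, s}" using x y by auto
      then show ?thesis using gx by auto
    qed
    ultimately show ?thesis unfolding t
      by (intro exI[of _ g] conjI) (blast, blast, (intro ballI, clarify, blast))
  qed
qed

section \<open>Cycle covers\<close>

definition cycle :: "('a \<Rightarrow> 'a \<Rightarrow> bool) \<Rightarrow> 'a list \<Rightarrow> bool" where
  "cycle E xs \<longleftrightarrow> distinct xs \<and> 3 \<le> length xs \<and> successively E xs \<and> E (last xs) (hd xs)"

section \<open>Rotating, reversing and opening cycles\<close>

lemma cycle_rev: "cycle E xs \<Longrightarrow> symp E \<Longrightarrow> cycle E (rev xs)"
  by (auto simp: cycle_def hd_rev last_rev symp_def elim: successively_mono)

lemma cycle_append_commute:
  assumes "cycle E (xs @ ys)" "ys \<noteq> []"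
  shows "cycle E (ys @ xs)"
  using assms by (cases "xs = []") (auto simp: cycle_def successively_append_iff)

lemma cycle_mono:
  assumes "cycle R xs" "\<And>x y. R x y \<Longrightarrow> E x y"
  shows "cycle E xs"
  using assms unfolding cycle_def by (blast intro: successively_mono)

lemma cycle_rotate_to:
  assumes "cycle E xs" "x \<in> set xs"
  obtains zs where "cycle E (x # zs)" "set xs = set (x # zs)"
proof -
  obtain us vs where "xs = us @ x # vs" using assms(2) by (meson split_list)
  then show thesis using that[of "vs @ us"] cycle_append_commute[of E us "x # vs"] assms(1) by auto
qed

lemma cycle_length_ge3:
  assumes "cycle E (x # zs)"
  obtains y ys where "zs = y # ys" "ys \<noteq> []"
proof (cases zs)
  case (Cons y ys)
  then show thesis using that assms by (cases "ys = []") (auto simp: cycle_def)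
qed (use assms in \<open>simp add: cycle_def\<close>)

lemma cycle_two_neighbours:
  assumes "cycle E xs" "symp E" "x \<in> set xs"
  obtains y z where "y \<in> set xs" "z \<in> set xs" "y \<noteq> z" "E x y" "E x z"
proof -
  obtain zs where zs: "cycle E (x # zs)" "set xs = set (x # zs)"
    using cycle_rotate_to[OF assms(1,3)] .
  obtain y ys where ys: "zs = y # ys" "ys \<noteq> []"
    using cycle_length_ge3[OF zs(1)] .
  show thesis
  proof (rule that[of y "last ys"])
    show "y \<in> set xs" "last ys \<in> set xs" using zs(2) ys by auto
    show "y \<noteq> last ys" using zs(1) ys by (auto simp: cycle_def)
    show "E x y" using zs(1) ys by (simp add: cycle_def)
    have "E (last ys) x" using zs(1) ys by (simp add: cycle_def)
    then show "E x (last ys)" by (rule sympD[OF assms(2)])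
  qed
qed

text \<open>One of the three neighbours of \<open>v\<close> lies off the cycle, so the other two are
  its neighbours on the cycle and \<open>y\<close> is one of them. Rotating, and reversing if
  necessary, opens the cycle at the edge \<open>v y\<close>, ready to be spliced into another
  one.\<close>

lemma cycle_with_end_edge:
  assumes "cycle E xs" "symp E" "v \<in> set xs" "card {u. E v u} = 3"
    and "E v x" "x \<notin> set xs" "E v y" "y \<noteq> x"
  obtains ys where "cycle E ys" "set ys = set xs" "hd ys = y" "last ys = v"
proof -
  obtain zs where zs: "cycle E (v # zs)" "set xs = set (v # zs)"
    using cycle_rotate_to[OF assms(1,3)] .
  obtain b bs where bs: "zs = b # bs" "bs \<noteq> []"
    using cycle_length_ge3[OF zs(1)] .
  let ?c = "last bs"
  have c: "?c \<in> set bs" using bs by simp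
  have E: "E v b" "E ?c v" using zs(1) bs by (simp_all add: cycle_def)
  have E': "E v ?c" using E(2) by (rule sympD[OF assms(2)])
  have d: "b \<noteq> ?c" "b \<noteq> x" "?c \<noteq> x" using zs(1) c assms(6) unfolding zs(2) bs(1) cycle_def by auto
  have "finite {u. E v u}" using assms(4) card_gt_0_iff by fastforce
  moreover have "card {x, b, ?c} = 3" using d by auto
  ultimately have "{x, b, ?c} = {u. E v u}"
    using assms(4,5) E E' by (intro card_subset_eq) auto
  then have "y = b \<or> y = ?c" using assms(7,8) by blast
  then show thesis
  proof
    assume y: "y = b"
    have "cycle E (zs @ [v])" using cycle_append_commute[of E "[v]" zs] zs(1) bs by simp
    then show thesis using that[of "zs @ [v]"] zs(2) y bs by auto
  next
    assume y: "y = ?c"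
    show thesis using that[of "rev (v # zs)"] cycle_rev[OF zs(1) assms(2)] zs(2) y bs
      by (auto simp: hd_append hd_rev)
  qed
qed

text \<open>A 2-factor. Since different lists must have disjoint vertex sets, no cycle occurs under
  two rotations and \<open>card Q\<close> is the number of cycles.\<close>

definition cycle_cover :: "('a \<Rightarrow> 'a \<Rightarrow> bool) \<Rightarrow> 'a set \<Rightarrow> 'a list set \<Rightarrow> bool" where
  "cycle_cover E V Q \<longleftrightarrow> finite Q \<and> (\<forall>xs\<in>Q. cycle E xs) \<and> (\<Union>xs\<in>Q. set xs) = V \<and>
     (\<forall>xs\<in>Q. \<forall>ys\<in>Q. xs \<noteq> ys \<longrightarrow> set xs \<inter> set ys = {})"

text \<open>Both neighbours of the last vertex of a longest path lie on the path, and the edge to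
  the earlier one closes up the tail of the path.\<close>

lemma two_regular_has_cycle:
  assumes "finite V" "V \<noteq> {}" and two: "\<And>v. v \<in> V \<Longrightarrow> card {u. R v u} = 2"
    and sub: "\<And>u v. R u v \<Longrightarrow> u \<in> V \<and> v \<in> V" and "symp R" "irreflp R"
  obtains zs where "cycle R zs" "set zs \<subseteq> V"
proof -
  note result = that
  let ?P = "\<lambda>xs. distinct xs \<and> successively R xs \<and> set xs \<subseteq> V \<and> xs \<noteq> []"
  obtain v where "v \<in> V" using assms(2) by blast
  then have "?P [v]" by simp
  moreover have "\<forall>xs. ?P xs \<longrightarrow> length xs \<le> card V"
    using assms(1) by (metis card_mono distinct_card)
  ultimately obtain xs where xs: "?P xs" "\<And>ys. ?P ys \<Longrightarrow> length ys \<le> length xs"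
    using ex_has_greatest_nat[of ?P "[v]" length "Suc (card V)"] le_imp_less_Suc by blast
  let ?z = "last xs"
  have z: "?z \<in> V" using xs(1) last_in_set by blast
  have nb: "u \<in> set xs" if "R ?z u" for u
  proof (rule ccontr)
    assume "u \<notin> set xs"
    then have "?P (xs @ [u])" using xs(1) that sub by (auto simp: successively_append_iff)
    then show False using xs(2)[of "xs @ [u]"] by simp
  qed
  obtain p q where pq: "{u. R ?z u} = {p, q}" "p \<noteq> q" using two[OF z] by (auto simp: card_2_iff)
  have R: "R ?z p" "R ?z q" using pq by auto
  then obtain i j where ij: "i < length xs" "xs ! i = p" "j < length xs" "xs ! j = q"
    using nb by (metis in_set_conv_nth)
  have main: thesis if ij: "i < j" "j < length xs" "R ?z (xs ! i)" "R ?z (xs ! j)" for i j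
  proof (rule result[of "drop i xs"])
    \<comment> \<open>The later neighbour lies strictly between \<open>xs ! i\<close> and the end,
      so the tail has at least three vertices.\<close>
    have "xs ! j \<noteq> ?z" using ij \<open>irreflp R\<close> by (metis irreflp_def)
    then have "j \<noteq> length xs - 1" using xs(1) by (metis last_conv_nth)
    then have "i + 3 \<le> length xs" using ij by linarith
    moreover have "successively R (drop i xs)"
      using xs(1) by (auto simp: successively_conv_nth)
    ultimately show "cycle R (drop i xs)" using xs(1) ij
      by (auto simp: cycle_def hd_drop_conv_nth)
    show "set (drop i xs) \<subseteq> V" using xs(1) set_drop_subset[of i xs] by auto
  qed
  have "i \<noteq> j" using ij pq(2) by blast
  then consider "i < j" | "j < i" by linarith
  then show thesis using main[of i j] main[of j i] ij R by cases auto
qed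

lemma two_regular_cycle_cover:
  assumes "finite V" and "\<And>v. v \<in> V \<Longrightarrow> card {u. R v u} = 2"
    and "\<And>u v. R u v \<Longrightarrow> u \<in> V \<and> v \<in> V" and "symp R" "irreflp R"
  shows "\<exists>Q. cycle_cover R V Q"
  using assms
proof (induction V arbitrary: R rule: finite_psubset_induct)
  case (psubset V)
  note two = psubset.prems(1) and sub = psubset.prems(2)
    and sym = psubset.prems(3) and irr = psubset.prems(4)
  show ?case
  proof (cases "V = {}")
    case True
    then show ?thesis by (auto simp: cycle_cover_def intro: exI[of _ "{}"])
  next
    case False
    then obtain zs where zs: "cycle R zs" "set zs \<subseteq> V"
      using two_regular_has_cycle[OF psubset.hyps(1) False two sub sym irr] by blast
    have closed: "v \<in> set zs" if "u \<in> set zs" "R u v" for u v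
    proof -
      obtain y z where yz: "y \<in> set zs" "z \<in> set zs" "y \<noteq> z" "R u y" "R u z"
        using cycle_two_neighbours[OF zs(1) sym \<open>u \<in> set zs\<close>] .
      have c2: "card {w. R u w} = 2" using two that zs by blast
      then have "finite {w. R u w}" using card_gt_0_iff by fastforce
      then have "{y, z} = {w. R u w}" using yz c2 by (intro card_subset_eq) auto
      then have "v \<in> {y, z}" using that by simp
      then show ?thesis using yz by blast
    qed
    \<comment> \<open>Constraining the first end suffices: by \<open>closed\<close> and symmetry no
      edge joins \<open>zs\<close> to the rest, and vertices off \<open>zs\<close> keep their whole
      neighbourhood.\<close>
    let ?R = "\<lambda>u v. R u v \<and> u \<notin> set zs"
    have "\<exists>Q. cycle_cover ?R (V - set zs) Q"
    proof (rule psubset.IH)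
      show "V - set zs \<subset> V" using zs by (cases zs) (auto simp: cycle_def)
      show "card {u. ?R v u} = 2" if "v \<in> V - set zs" for v using two that by simp
      show "u \<in> V - set zs \<and> v \<in> V - set zs" if "?R u v" for u v
        using that sub closed sym by (meson DiffI sympD)
      show "symp ?R" using closed sym by (auto simp: symp_def)
      show "irreflp ?R" using irr by (auto simp: irreflp_def)
    qed
    then obtain Q where Q: "cycle_cover ?R (V - set zs) Q" by blast
    have "cycle_cover R V (insert zs Q)"
      using Q zs cycle_mono[of ?R _ R] by (auto simp: cycle_cover_def)
    then show ?thesis by blast
  qed
qed

text \<open>The edge \<open>v1 v2\<close> joins two different cycles, so by cubicity
  \<open>v1 v4\<close> and \<open>v2 v3\<close> are edges of these cycles and both can be opened
  there. The conclusions say that \<open>zs\<close> is the only new cycle and that it is longer than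
  \<open>xs\<close>, so merging away a 4-cycle cannot create another one.\<close>

lemma cycle_cover_merge:
  assumes Q: "cycle_cover E V Q" and sym: "symp E" and cubic: "\<And>v. v \<in> V \<Longrightarrow> card {u. E v u} = 3"
    and xs: "xs \<in> Q" and v: "v1 \<in> V" "v1 \<notin> set xs" "v2 \<in> set xs"
    and E: "E v1 v2" "E v2 v3" "E v3 v4" "E v4 v1" and ne: "v1 \<noteq> v3" "v2 \<noteq> v4"
  obtains zs Q' where "zs \<in> Q'" "Q' - {zs} \<subseteq> Q" "cycle_cover E V Q'" "card Q' < card Q"
    "length zs > length xs"
proof -
  have cyc: "\<And>xs. xs \<in> Q \<Longrightarrow> cycle E xs" and disj: "\<And>xs ys. xs \<in> Q \<Longrightarrow> ys \<in> Q \<Longrightarrow> xs \<noteq> ys \<Longrightarrow> set xs \<inter> set ys = {}"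
    and U: "(\<Union>xs\<in>Q. set xs) = V" and fin: "finite Q" using Q by (auto simp: cycle_cover_def)
  obtain ds where ds: "ds \<in> Q" "v1 \<in> set ds" using v U by blast
  have ne': "ds \<noteq> xs" using ds v by blast
  have v2: "v2 \<notin> set ds" "v2 \<in> V" using disj[OF ds(1) xs ne'] v xs U by blast+
  obtain ys where ys: "cycle E ys" "set ys = set ds" "hd ys = v4" "last ys = v1"
    using cycle_with_end_edge[OF cyc[OF ds(1)] sym ds(2) cubic[OF v(1)] E(1) v2(1)
        sympD[OF sym E(4)] ne(2)[symmetric]] .
  obtain us where us: "cycle E us" "set us = set xs" "hd us = v3" "last us = v2"
    using cycle_with_end_edge[OF cyc[OF xs] sym v(3) cubic[OF v2(2)]
        sympD[OF sym E(1)] v(2) E(2) ne(1)[symmetric]] .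
  \<comment> \<open>\<open>ys\<close> runs from \<open>v4\<close> to \<open>v1\<close> and
    \<open>rev us\<close> from \<open>v2\<close> to \<open>v3\<close>, so the junction is
    \<open>v1 v2\<close> and the closing edge is \<open>v3 v4\<close>.\<close>
  let ?zs = "ys @ rev us" and ?Q = "Q - {xs, ds}"
  have nonempty: "ys \<noteq> []" "us \<noteq> []" using ys us by (auto simp: cycle_def)
  have "successively E (rev us)" using cycle_rev[OF us(1) sym] by (simp add: cycle_def)
  then have zs: "cycle E ?zs" using ys us disj[OF ds(1) xs ne'] E nonempty
    by (auto simp: cycle_def successively_append_iff hd_rev last_rev)
  have set_zs: "set ?zs = set ds \<union> set xs" using ys us by simp
  have new: "?zs \<notin> ?Q"
  proof
    assume "?zs \<in> ?Q"
    then have "set ?zs \<inter> set xs = {}" using disj xs by blast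
    then show False using set_zs v(3) by blast
  qed
  \<comment> \<open>Two cycles go and one comes; the bound keeps the subtraction on
    \<open>nat\<close> from being truncated.\<close>
  have "card {xs, ds} \<le> card Q" using fin xs ds by (intro card_mono) auto
  then have "card (insert ?zs ?Q) < card Q"
    using new fin xs ds ne' by (simp add: card_Diff_subset)
  moreover have "cycle_cover E V (insert ?zs ?Q)"
    unfolding cycle_cover_def
  proof (intro conjI ballI impI)
    show "finite (insert ?zs ?Q)" using fin by simp
    show "cycle E as" if "as \<in> insert ?zs ?Q" for as using that zs cyc by blast
    have "(\<Union>as\<in>insert ?zs ?Q. set as) = set ?zs \<union> (\<Union>as\<in>?Q. set as)" by blast
    also have "\<dots> = V" unfolding set_zs using U xs ds by blast
    finally show "(\<Union>as\<in>insert ?zs ?Q. set as) = V" .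
    have *: "set ?zs \<inter> set as = {}" if "as \<in> ?Q" for as
      unfolding set_zs using disj[of as ds] disj[of as xs] that xs ds by blast
    fix as bs assume "as \<in> insert ?zs ?Q" "bs \<in> insert ?zs ?Q" "as \<noteq> bs"
    then show "set as \<inter> set bs = {}" using * disj by blast
  qed
  moreover have "length ?zs > length xs"
  proof -
    have "length us = length xs"
      using us cyc[OF xs] by (metis cycle_def distinct_card)
    then show ?thesis using nonempty by simp
  qed
  ultimately show thesis by (intro that[of ?zs "insert ?zs ?Q"]) auto
qed

section \<open>Cutting cycles into induced paths\<close>

text \<open>The bound is relative to \<open>card S\<close>, so it is additive over disjoint unions
  and can be checked piece by piece. \<open>finite P\<close> rules out the value 0 that
  \<open>card\<close> gives to infinite sets.\<close>

definition third_IPD :: "('a \<Rightarrow> 'a \<Rightarrow> bool) \<Rightarrow> 'a set \<Rightarrow> bool" where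
  "third_IPD E S \<longleftrightarrow> (\<exists>P. is_IPD S E P \<and> finite P \<and> 3 * card P \<le> card S)"

lemma third_IPD_empty: "third_IPD E {}"
  unfolding third_IPD_def by (rule exI[of _ "{}"]) (simp add: is_IPD_def)

lemma third_IPD_induced_path: "induced_path E S \<Longrightarrow> 3 \<le> card S \<Longrightarrow> third_IPD E S"
  unfolding third_IPD_def by (rule exI[of _ "{S}"]) (simp add: is_IPD_def)

lemma third_IPD_Un:
  assumes "third_IPD E S" "third_IPD E T" "S \<inter> T = {}" "finite S" "finite T"
  shows "third_IPD E (S \<union> T)"
proof -
  obtain P Q where P: "is_IPD S E P" "finite P" "3 * card P \<le> card S"
    and Q: "is_IPD T E Q" "finite Q" "3 * card Q \<le> card T"
    using assms(1,2) by (auto simp: third_IPD_def)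
  have "3 * card (P \<union> Q) \<le> card (S \<union> T)"
    using card_Un_le[of P Q] P(3) Q(3) card_Un_disjoint[OF assms(4,5,3)] by linarith
  moreover have "X \<inter> Y = {}" if "X \<in> P" "Y \<in> Q" for X Y
    using P(1) Q(1) assms(3) that unfolding is_IPD_def by blast
  then have "\<forall>X\<in>P \<union> Q. \<forall>Y\<in>P \<union> Q. X \<noteq> Y \<longrightarrow> X \<inter> Y = {}"
    using P(1) Q(1) unfolding is_IPD_def by (metis Int_commute Un_iff)
  then have "is_IPD (S \<union> T) E (P \<union> Q)" using P(1) Q(1) unfolding is_IPD_def by auto
  ultimately show ?thesis unfolding third_IPD_def using P(2) Q(2) by blast
qed

text \<open>The cycle is unrolled to a sequence of period \<open>L\<close>, so that windows may
  start anywhere and run past the end without modular arithmetic.\<close>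

locale bipartite_cubic_cycle =
  fixes E :: "'a \<Rightarrow> 'a \<Rightarrow> bool" and A :: "'a set" and c :: "nat \<Rightarrow> 'a" and L :: nat
  assumes sym: "E u v \<Longrightarrow> E v u"
    and col: "E u v \<Longrightarrow> u \<in> A \<longleftrightarrow> v \<notin> A"
    and step: "E (c i) (c (Suc i))"
    and inj: "inj_on c {i..<i + L}"
    and period: "c (i + L) = c i"
    and degree: "card {u. E (c i) u} = 3"
    and L: "6 \<le> L"
begin

section \<open>Chords and induced windows of a cycle\<close>

lemma parity: "c i \<in> A \<longleftrightarrow> (c 0 \<in> A \<longleftrightarrow> even i)"
proof (induction i)
  case (Suc i)
  then show ?case using col[OF step[of i]] by (simp, blast)
qed simp

lemma adj_odd: "E (c i) (c j) \<Longrightarrow> odd (i + j)"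
  using col[of "c i" "c j"] parity[of i] parity[of j] by auto

lemma even_L: "even L"
  using parity[of L] period[of 0] by auto

text \<open>Shifting the window by one loses \<open>c i\<close> and gains \<open>c (i + L)\<close>,
  which is the same vertex.\<close>

lemma window_all: "c ` {i..<i + L} = c ` {0..<L}"
proof (induction i)
  case (Suc i)
  have "{Suc i..<Suc i + L} = insert (i + L) {Suc i..<i + L}" using L by auto
  then have "c ` {Suc i..<Suc i + L} = insert (c i) (c ` {Suc i..<i + L})"
    using period by (metis image_insert)
  also have "\<dots> = c ` insert i {Suc i..<i + L}" by simp
  also have "insert i {Suc i..<i + L} = {i..<i + L}" using L by auto
  finally show ?case using Suc by simp
qed simp

lemma window_third_IPD:
  assumes "3 \<le> m" "m \<le> L"
    and ind: "\<And>a b. a < b \<Longrightarrow> b < m \<Longrightarrow> E (c (i + a)) (c (i + b)) \<Longrightarrow> b = Suc a"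
  shows "third_IPD E (c ` {i..<i + m})"
proof (rule third_IPD_induced_path)
  have inj': "inj_on c {i..<i + m}" by (rule inj_on_subset[OF inj[of i]]) (use assms in auto)
  show "3 \<le> card (c ` {i..<i + m})" using inj' assms by (simp add: card_image)
  show "induced_path E (c ` {i..<i + m})"
    unfolding induced_path_def
  proof (intro exI[of _ "map c [i..<i + m]"] conjI allI impI)
    show "distinct (map c [i..<i + m])" using inj' by (simp add: distinct_map)
    show "set (map c [i..<i + m]) = c ` {i..<i + m}" by simp
    fix a b assume "a < length (map c [i..<i + m])" "b < length (map c [i..<i + m])"
    then have ab: "a < m" "b < m" by auto
    have "E (c (i + a)) (c (i + b)) \<longleftrightarrow> (a = Suc b \<or> b = Suc a)"
    proof
      assume e: "E (c (i + a)) (c (i + b))"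
      have "a \<noteq> b" using adj_odd[OF e] by auto
      then show "a = Suc b \<or> b = Suc a"
        using ind[of a b] ind[of b a] e sym[OF e] ab by (meson nat_neq_iff)
    next
      assume "a = Suc b \<or> b = Suc a"
      then show "E (c (i + a)) (c (i + b))"
        using step[of "i + a"] sym[OF step[of "i + b"]] by auto
    qed
    then show "E (map c [i..<i + m] ! a) (map c [i..<i + m] ! b) \<longleftrightarrow> (a = Suc b \<or> b = Suc a)"
      using ab by simp
  qed
qed

lemma window_append:
  assumes "third_IPD E (c ` {i..<i + m})" "third_IPD E (c ` {i + m..<i + m + k})"
    and "n = m + k" "n \<le> L"
  shows "third_IPD E (c ` {i..<i + n})"
proof -
  have "{i..<i + n} = {i..<i + m} \<union> {i + m..<i + m + k}" using assms by auto
  moreover have "c ` {i..<i + m} \<inter> c ` {i + m..<i + m + k} = {}"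
  proof -
    have "c ` {i..<i + m} \<inter> c ` {i + m..<i + m + k} = c ` ({i..<i + m} \<inter> {i + m..<i + m + k})"
      by (rule inj_on_image_Int[OF inj[of i], symmetric]) (use assms in auto)
    then show ?thesis by auto
  qed
  ultimately show ?thesis using third_IPD_Un[OF assms(1,2)] by (simp add: image_Un)
qed

text \<open>The ends have the same colour, so they are not adjacent. In the windows of order 4 and 5
  below, parity likewise leaves only chords between indices at distance 3.\<close>

lemma window3: "third_IPD E (c ` {i..<i + 3})"
proof (rule window_third_IPD)
  fix a b :: nat assume ab: "a < b" "b < 3" "E (c (i + a)) (c (i + b))"
  have "odd (a + b)" using adj_odd[OF ab(3)] by presburger
  then show "b = Suc a" using ab(1,2) by presburger
qed (use L in auto)

lemma window3k: "3 * k \<le> L \<Longrightarrow> third_IPD E (c ` {i..<i + 3 * k})"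
proof (induction k)
  case 0
  then show ?case by (simp add: third_IPD_empty)
next
  case (Suc k)
  then have "third_IPD E (c ` {i..<i + 3 * k})" by simp
  then show ?case by (rule window_append[OF _ window3]) (use Suc.prems in auto)
qed

lemma window4:
  assumes "\<not> E (c i) (c (i + 3))"
  shows "third_IPD E (c ` {i..<i + 4})"
proof (rule window_third_IPD)
  fix a b :: nat assume ab: "a < b" "b < 4" "E (c (i + a)) (c (i + b))"
  have "odd (a + b)" using adj_odd[OF ab(3)] by presburger
  moreover have "\<not> (a = 0 \<and> b = 3)" using assms ab by auto
  ultimately show "b = Suc a" using ab(1,2) by presburger
qed (use L in auto)

lemma window5:
  assumes "\<not> E (c i) (c (i + 3))" "\<not> E (c (i + 1)) (c (i + 4))"
  shows "third_IPD E (c ` {i..<i + 5})"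
proof (rule window_third_IPD)
  fix a b :: nat assume ab: "a < b" "b < 5" "E (c (i + a)) (c (i + b))"
  have "odd (a + b)" using adj_odd[OF ab(3)] by presburger
  moreover have "\<not> (a = 0 \<and> b = 3)" "\<not> (a = 1 \<and> b = 4)" using assms ab by auto
  ultimately show "b = Suc a" using ab(1,2) by presburger
qed (use L in auto)

text \<open>Otherwise \<open>c (i + 3)\<close> has the four neighbours with indices
  \<open>i\<close>, \<open>i + 2\<close>, \<open>i + 4\<close> and \<open>i + 6\<close>, which are
  distinct because \<open>6 < L\<close>.\<close>

lemma no_consecutive_chords:
  assumes "E (c i) (c (i + 3))" "E (c (i + 3)) (c (i + 6))" "6 < L"
  shows False
proof -
  let ?v = "c (i + 3)"
  have "E ?v (c i)" "E ?v (c (i + 2))" "E ?v (c (i + 4))" "E ?v (c (i + 6))"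
    using sym[OF assms(1)] sym[OF step[of "i + 2"]] step[of "i + 3"] assms(2)
    by (simp_all add: eval_nat_numeral)
  then have sub: "c ` {i, i + 2, i + 4, i + 6} \<subseteq> {u. E ?v u}" by auto
  have "inj_on c {i, i + 2, i + 4, i + 6}" by (rule inj_on_subset[OF inj[of i]]) (use assms in auto)
  then have "card (c ` {i, i + 2, i + 4, i + 6}) = 4" by (simp add: card_image)
  moreover have "finite {u. E ?v u}" using degree[of "i + 3"] card_gt_0_iff by fastforce
  ultimately show False using card_mono[OF _ sub] degree[of "i + 3"] by simp
qed

lemma chordless_window: "6 < L \<Longrightarrow> \<exists>i. \<not> E (c i) (c (i + 3))"
  using no_consecutive_chords[of 0] by (metis add_0 numeral_Bit0)

lemma cycle_third_IPD: "third_IPD E (c ` {0..<L})"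
proof -
  \<comment> \<open>The residue of \<open>L\<close> modulo 3. As \<open>L\<close> is even and at
    least 6, the residue 2 forces \<open>L \<ge> 8\<close>, which leaves room for two windows of
    order 4.\<close>
  consider k where "L = 3 * k" | k where "L = 3 * k + 4" "6 < L" | k where "L = 3 * k + 8" "6 < L"
  proof -
    have "L = 3 * (L div 3) \<or> (L = 3 * (L div 3 - 1) + 4 \<and> 6 < L) \<or> (L = 3 * (L div 3 - 2) + 8 \<and> 6 < L)"
      using L even_L by presburger
    then show thesis using that by blast
  qed
  then show ?thesis
  proof cases
    case 1
    then show ?thesis using window3k[of k 0] by simp
  next
    case 2
    obtain i where "\<not> E (c i) (c (i + 3))"
      using chordless_window 2 by blast
    then have "third_IPD E (c ` {i..<i + L})"
      by (rule window_append[OF window4 window3k[of k]]) (use 2 in auto)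
    then show ?thesis using window_all by simp
  next
    case 3
    show ?thesis
    proof (cases "\<exists>i. \<not> E (c i) (c (i + 3)) \<and> \<not> E (c (i + 1)) (c (i + 4))")
      case True
      then obtain i where i: "\<not> E (c i) (c (i + 3))" "\<not> E (c (i + 1)) (c (i + 4))" by blast
      have "third_IPD E (c ` {i..<i + L})"
        by (rule window_append[OF window5[OF i] window3k[of "k + 1"]]) (use 3 in auto)
      then show ?thesis using window_all by simp
    next
      case False
      obtain i where i: "\<not> E (c i) (c (i + 3))"
        using chordless_window 3 by blast
      \<comment> \<open>The chord starting at \<open>i + 1\<close> ends at \<open>i + 4\<close>, so
        none starts at \<open>i + 4\<close>: the windows of order 4 at \<open>i\<close> and at
        \<open>i + 4\<close> are both induced.\<close>
      then have "E (c (i + 1)) (c (i + 4))" using False by blast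
      then have i4: "\<not> E (c (i + 4)) (c (i + 4 + 3))"
        using no_consecutive_chords[of "i + 1"] 3 by (auto simp: ac_simps)
      have "third_IPD E (c ` {i..<i + 8})"
        by (rule window_append[OF window4[OF i] window4[OF i4]]) (use 3 in auto)
      then have "third_IPD E (c ` {i..<i + L})"
        by (rule window_append[OF _ window3k[of k]]) (use 3 in auto)
      then show ?thesis using window_all by simp
    qed
  qed
qed

end

text \<open>Indices modulo the length unroll the list. The colours alternate along it, so the length
  is even; being at least 3 and not 4, it is at least 6.\<close>

lemma cycle_list_third_IPD:
  assumes "cycle E xs" and "symp E" and col: "\<And>u v. E u v \<Longrightarrow> u \<in> A \<longleftrightarrow> v \<notin> A"
    and deg: "\<And>v. v \<in> set xs \<Longrightarrow> card {u. E v u} = 3" and "length xs \<noteq> 4"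
  shows "third_IPD E (set xs)"
proof -
  let ?L = "length xs"
  define c where "c i = xs ! (i mod ?L)" for i
  have L3: "3 \<le> ?L" and dist: "distinct xs" using assms(1) by (auto simp: cycle_def)
  then have L0: "?L > 0" by linarith
  have step: "E (c i) (c (Suc i))" for i
  proof (cases "Suc (i mod ?L) = ?L")
    case True
    then have "i mod ?L = ?L - 1" by simp
    then have "c (Suc i) = hd xs" "c i = last xs"
      using L0 True by (auto simp: c_def mod_Suc hd_conv_nth last_conv_nth)
    then show ?thesis using assms(1) by (simp add: cycle_def)
  next
    case False
    then have "Suc (i mod ?L) < ?L" using L0 by (metis Suc_lessI mod_less_divisor)
    moreover from False have "Suc i mod ?L = Suc (i mod ?L)" by (simp add: mod_Suc)
    ultimately show ?thesis
      using assms(1) successively_nth[of E xs "i mod ?L"] by (simp add: cycle_def c_def)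
  qed
  have parity: "c i \<in> A \<longleftrightarrow> (c 0 \<in> A \<longleftrightarrow> even i)" for i
  proof (induction i)
    case (Suc i)
    then show ?case using col[OF step[of i]] by (simp, blast)
  qed simp
  have "even ?L" using parity[of ?L] by (auto simp: c_def)
  then have L6: "6 \<le> ?L" using L3 assms(5) by presburger
  interpret bipartite_cubic_cycle E A c ?L
  proof
    show "E v u" if "E u v" for u v using that assms(2) by (rule sympD[rotated])
    show "card {u. E (c i) u} = 3" for i using deg L0 by (simp add: c_def)
    show "inj_on c {i..<i + ?L}" for i
    proof (rule inj_onI)
      fix a b assume ab: "a \<in> {i..<i + ?L}" "b \<in> {i..<i + ?L}" "c a = c b"
      then have m: "a mod ?L = b mod ?L" using dist L0 by (simp add: c_def nth_eq_iff_index_eq)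
      have *: "y = x" if "x \<le> y" "y < x + ?L" "x mod ?L = y mod ?L" for x y :: nat
      proof -
        have "?L dvd y - x" using that by (metis mod_eq_dvd_iff_nat)
        moreover have "y - x < ?L" using that by linarith
        ultimately have "y - x = 0" using nat_dvd_not_less by blast
        then show ?thesis using that by simp
      qed
      have "a < b + ?L" "b < a + ?L" using ab(1,2) by auto
      then show "a = b" using *[OF _ _ m] *[OF _ _ m[symmetric]] nat_le_linear[of a b] by metis
    qed
  qed (use col step L6 in \<open>auto simp: c_def\<close>)
  have "c ` {0..<?L} = set xs"
    by (auto simp: c_def in_set_conv_nth image_iff intro!: bexI)
  then show ?thesis using cycle_third_IPD by simp
qed

lemma cycle_cover_third_IPD:
  assumes "cycle_cover E V Q" and "symp E" and "\<And>u v. E u v \<Longrightarrow> u \<in> A \<longleftrightarrow> v \<notin> A"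
    and deg: "\<And>v. v \<in> V \<Longrightarrow> card {u. E v u} = 3" and len: "\<And>xs. xs \<in> Q \<Longrightarrow> length xs \<noteq> 4"
  shows "third_IPD E V"
proof -
  have Q: "finite Q" "\<And>xs. xs \<in> Q \<Longrightarrow> cycle E xs" "(\<Union>xs\<in>Q. set xs) = V"
    "\<And>xs ys. xs \<in> Q \<Longrightarrow> ys \<in> Q \<Longrightarrow> xs \<noteq> ys \<Longrightarrow> set xs \<inter> set ys = {}"
    using assms(1) by (auto simp: cycle_cover_def)
  have each: "third_IPD E (set xs)" if "xs \<in> Q" for xs
    by (rule cycle_list_third_IPD[of E xs A]) (use that assms Q in auto)
  have "third_IPD E (\<Union>xs\<in>Q'. set xs)" if "Q' \<subseteq> Q" for Q'
    using finite_subset[OF that Q(1)] that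
  proof (induction Q' rule: finite_induct)
    case empty
    then show ?case by (simp add: third_IPD_empty)
  next
    case (insert xs Q')
    have "third_IPD E (set xs \<union> (\<Union>xs\<in>Q'. set xs))"
    proof (rule third_IPD_Un)
      show "set xs \<inter> (\<Union>xs\<in>Q'. set xs) = {}" using insert.hyps(2) insert.prems Q(4) by blast
    qed (use insert each in auto)
    then show ?case by simp
  qed
  then show ?thesis using Q(3) by blast
qed

section \<open>A 2-factor without 4-cycles\<close>

locale bipartite_cubic_graph =
  fixes A B :: "'a set" and E :: "'a \<Rightarrow> 'a \<Rightarrow> bool"
  assumes finite_A: "finite A" and finite_B: "finite B" and disjoint: "A \<inter> B = {}"
    and edge: "E u v \<Longrightarrow> u \<in> A \<and> v \<in> B \<or> u \<in> B \<and> v \<in> A"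
    and sym: "symp E"
    and degree3: "v \<in> A \<union> B \<Longrightarrow> card {u. E v u} = 3"
begin

section \<open>The graph as 0/1 weights, and 4-cycles as copies of \<open>k22\<close>\<close>

definition w :: "'a \<Rightarrow> 'a \<Rightarrow> nat" where "w a b = (if E a b then 1 else 0)"

abbreviation is_C4 :: "'a \<times> 'a \<times> 'a \<times> 'a \<Rightarrow> bool" where
  "is_C4 \<equiv> k22 A B w"

definition vertices :: "'a \<times> 'a \<times> 'a \<times> 'a \<Rightarrow> 'a set" where
  "vertices = (\<lambda>(p, q, r, s). {p, q, r, s})"

lemma is_C4_iff: "is_C4 (p, q, r, s) \<longleftrightarrow> p \<in> A \<and> q \<in> A \<and> p \<noteq> q \<and> r \<in> B \<and> s \<in> B \<and> r \<noteq> s \<and>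
     E p r \<and> E p s \<and> E q r \<and> E q s"
  by (auto simp: k22_def w_def)

lemma row: "a \<in> A \<Longrightarrow> (\<Sum>b\<in>B. w a b) = 3"
proof -
  assume a: "a \<in> A"
  have "(\<Sum>b\<in>B. w a b) = card {b \<in> B. E a b}" using finite_B by (simp add: w_def sum.If_cases Int_def)
  also have "{b \<in> B. E a b} = {b. E a b}" using edge a disjoint by blast
  finally show ?thesis using degree3 a by simp
qed

lemma column: "b \<in> B \<Longrightarrow> (\<Sum>a\<in>A. w a b) = 3"
proof -
  assume b: "b \<in> B"
  have "(\<Sum>a\<in>A. w a b) = card {a \<in> A. E a b}" using finite_A by (simp add: w_def sum.If_cases Int_def)
  also have "{a \<in> A. E a b} = {a. E b a}" using edge b disjoint sympD[OF sym] by blast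
  finally show ?thesis using degree3 b by simp
qed

text \<open>Deleting a perfect matching \<open>f\<close> leaves a 2-regular graph \<open>R\<close>.
  If one of its cycles had the vertex set of a quadruple in \<open>F\<close>, each \<open>a\<close>
  in \<open>{p, q}\<close> would have both of \<open>r\<close>, \<open>s\<close> as
  \<open>R\<close>-neighbours; but for some such \<open>a\<close> the matching has removed an edge
  to \<open>r\<close> or \<open>s\<close>.\<close>

lemma cycle_cover_avoiding:
  assumes "finite F" and C4: "\<And>t. t \<in> F \<Longrightarrow> is_C4 t"
    and disj: "\<And>t t'. t \<in> F \<Longrightarrow> t' \<in> F \<Longrightarrow> t \<noteq> t' \<Longrightarrow> vertices t \<inter> vertices t' = {}"
  shows "\<exists>Q. cycle_cover E (A \<union> B) Q \<and> (\<forall>xs\<in>Q. set xs \<notin> vertices ` F)"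
proof -
  have "\<exists>f. bij_betw f A B \<and> (\<forall>a\<in>A. w a (f a) > 0) \<and>
    (\<forall>(p, q, r, s)\<in>F. f p \<in> {r, s} \<or> f q \<in> {r, s})"
  proof (rule cubic_weights_matching[OF assms(1) finite_A finite_B row column C4])
    fix p q r s p' q' r' s'
    assume "(p, q, r, s) \<in> F" "(p', q', r', s') \<in> F" "(p, q, r, s) \<noteq> (p', q', r', s')"
    then show "{p, q} \<inter> {p', q'} = {} \<and> {r, s} \<inter> {r', s'} = {}"
      using disj[of "(p, q, r, s)" "(p', q', r', s')"] unfolding vertices_def prod.case by blast
  qed
  then obtain f where f: "bij_betw f A B" "\<forall>a\<in>A. w a (f a) > 0"
    and fF: "\<forall>(p, q, r, s)\<in>F. f p \<in> {r, s} \<or> f q \<in> {r, s}" by blast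
  have fE: "E a (f a)" if "a \<in> A" for a using f(2) that by (auto simp: w_def split: if_splits)
  define R where "R u v \<longleftrightarrow> E u v \<and> \<not> (u \<in> A \<and> v = f u) \<and> \<not> (v \<in> A \<and> u = f v)" for u v
  have RE: "E u v" if "R u v" for u v using that by (simp add: R_def)
  have symR: "symp R" using sympD[OF sym] by (auto simp: R_def intro: sympI)
  have two: "card {u. R v u} = 2" if v: "v \<in> A \<union> B" for v
  proof -
    obtain m where m: "E v m" "{u. R v u} = {u. E v u} - {m}"
    proof (cases "v \<in> A")
      case True
      have "{u. R v u} = {u. E v u} - {f v}" using True edge disjoint by (auto simp: R_def)
      then show thesis using that fE[OF True] by blast
    next
      case False
      then obtain a where a: "a \<in> A" "f a = v" using v f(1) by (auto simp: bij_betw_def)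
      have "u = a" if "u \<in> A" "f u = v" for u
        using that a f(1) by (auto simp: bij_betw_def inj_on_def)
      then have "u \<in> A \<and> v = f u \<longleftrightarrow> u = a" for u using a by blast
      then have "{u. R v u} = {u. E v u} - {a}" using False by (simp add: R_def set_diff_eq)
      then show thesis using that sympD[OF sym fE[OF a(1)]] a by blast
    qed
    moreover have "finite {u. E v u}" using degree3[OF v] card_gt_0_iff by fastforce
    ultimately show ?thesis using degree3[OF v] by simp
  qed
  have "\<exists>Q. cycle_cover R (A \<union> B) Q"
  proof (rule two_regular_cycle_cover[OF _ two _ symR])
    show "finite (A \<union> B)" using finite_A finite_B by simp
    show "u \<in> A \<union> B \<and> v \<in> A \<union> B" if "R u v" for u v using edge[OF RE[OF that]] by blast
    show "irreflp R" using edge RE disjoint by (auto simp: irreflp_def) blast+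
  qed
  then obtain Q where Q: "cycle_cover R (A \<union> B) Q" by blast
  have "cycle E xs" if "cycle R xs" for xs using that RE by (rule cycle_mono)
  then have "cycle_cover E (A \<union> B) Q" using Q by (simp add: cycle_cover_def)
  moreover have "set xs \<notin> vertices ` F" if xs: "xs \<in> Q" for xs
  proof
    assume "set xs \<in> vertices ` F"
    then obtain p q r s where t: "(p, q, r, s) \<in> F" "set xs = {p, q, r, s}"
      by (auto simp: vertices_def)
    have c: "p \<in> A" "q \<in> A" "r \<in> B" "s \<in> B" using C4[OF t(1)] by (auto simp: is_C4_iff)
    have cyc: "cycle R xs" using Q xs by (simp add: cycle_cover_def)
    have False if a: "a \<in> {p, q}" "f a \<in> {r, s}" for a
    proof -
      have "a \<in> set xs" "a \<in> A" using a t c by auto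
      then obtain y z where yz: "y \<in> set xs" "z \<in> set xs" "y \<noteq> z" "R a y" "R a z"
        using cycle_two_neighbours[OF cyc symR] by metis
      have "y \<in> B" "z \<in> B" using edge[OF RE[OF yz(4)]] edge[OF RE[OF yz(5)]] \<open>a \<in> A\<close> disjoint by blast+
      then have "y \<in> {r, s}" "z \<in> {r, s}" using yz(1,2) t c disjoint by auto
      then have "f a = y \<or> f a = z" using yz(3) a(2) by blast
      then show False using yz(4,5) \<open>a \<in> A\<close> by (auto simp: R_def)
    qed
    moreover have "f p \<in> {r, s} \<or> f q \<in> {r, s}" using bspec[OF fF t(1)] by simp
    ultimately show False by blast
  qed
  ultimately show ?thesis by blast
qed

text \<open>A 4-cycle is connected, so one of its edges crosses the boundary of \<open>S\<close>.
  The eight cases are its four edges in both directions.\<close>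

lemma C4_leaving_set:
  assumes "is_C4 t" "\<not> vertices t \<subseteq> S" "vertices t \<inter> S \<noteq> {}"
  obtains v1 v2 v3 v4 where "v1 \<in> A \<union> B" "v1 \<notin> S" "v2 \<in> S" "E v1 v2" "E v2 v3" "E v3 v4" "E v4 v1"
    "v1 \<noteq> v3" "v2 \<noteq> v4"
proof -
  obtain p q r s where t: "t = (p, q, r, s)" by (cases t)
  have c: "p \<in> A" "q \<in> A" "p \<noteq> q" "r \<in> B" "s \<in> B" "r \<noteq> s" "E p r" "E p s" "E q r" "E q s"
    using assms(1) by (auto simp: t is_C4_iff)
  have c': "E r p" "E s p" "E r q" "E s q" using c sympD[OF sym] by blast+
  consider "p \<notin> S" "r \<in> S" | "p \<notin> S" "s \<in> S" | "q \<notin> S" "r \<in> S" | "q \<notin> S" "s \<in> S"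
    | "r \<notin> S" "p \<in> S" | "s \<notin> S" "p \<in> S" | "r \<notin> S" "q \<in> S" | "s \<notin> S" "q \<in> S"
    using assms(2,3) unfolding t vertices_def by auto
  then show thesis
  proof cases
    case 1 then show thesis using that[of p r q s] c c' by blast
  next
    case 2 then show thesis using that[of p s q r] c c' by blast
  next
    case 3 then show thesis using that[of q r p s] c c' by blast
  next
    case 4 then show thesis using that[of q s p r] c c' by blast
  next
    case 5 then show thesis using that[of r p s q] c c' by blast
  next
    case 6 then show thesis using that[of s p r q] c c' by blast
  next
    case 7 then show thesis using that[of r q s p] c c' by blast
  next
    case 8 then show thesis using that[of s q r p] c c' by blast
  qed
qed

lemma cycle_of_length_4:
  assumes "cycle E xs" "length xs = 4"
  obtains t where "is_C4 t" "set xs = vertices t"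
proof -
  obtain x y z u where xs: "xs = [x, y, z, u]"
    using assms(2) by (auto simp: eval_nat_numeral length_Suc_conv)
  have e: "E x y" "E y z" "E z u" "E u x" and d: "distinct [x, y, z, u]"
    using assms(1) by (auto simp: cycle_def xs)
  have e': "E y x" "E z y" "E u z" "E x u" using e sympD[OF sym] by blast+
  show thesis
  proof (cases "x \<in> A")
    case True
    then have "y \<in> B" "z \<in> A" "u \<in> B" using edge e disjoint by blast+
    then show thesis using that[of "(x, z, y, u)"] True e e' d by (auto simp: is_C4_iff vertices_def xs)
  next
    case False
    then have "x \<in> B" "y \<in> A" "z \<in> B" "u \<in> A" using edge e disjoint by blast+
    then show thesis using that[of "(y, u, x, z)"] e e' d by (auto simp: is_C4_iff vertices_def xs)
  qed
qed

text \<open>Vertex sets are used because several quadruples describe the same 4-cycle and must not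
  count as meeting one another.\<close>

definition isolated_C4s :: "'a set set" where
  "isolated_C4s = {C \<in> vertices ` Collect is_C4. \<forall>C'\<in>vertices ` Collect is_C4. C' \<noteq> C \<longrightarrow> C \<inter> C' = {}}"

lemma cycle_cover_no_isolated_C4:
  "\<exists>Q. cycle_cover E (A \<union> B) Q \<and> (\<forall>xs\<in>Q. set xs \<notin> isolated_C4s)"
proof -
  \<comment> \<open>One quadruple per vertex set: two quadruples of the same 4-cycle would violate
    the disjointness that \<open>cycle_cover_avoiding\<close> requires.\<close>
  define pick where "pick C = (SOME t. is_C4 t \<and> vertices t = C)" for C
  have pick: "is_C4 (pick C) \<and> vertices (pick C) = C" if "C \<in> isolated_C4s" for C
    unfolding pick_def by (rule someI_ex) (use that in \<open>auto simp: isolated_C4s_def\<close>)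
  have "isolated_C4s \<subseteq> Pow (A \<union> B)"
    by (auto simp: isolated_C4s_def vertices_def is_C4_iff)
  then have "finite isolated_C4s" using finite_A finite_B finite_subset by blast
  have "\<exists>Q. cycle_cover E (A \<union> B) Q \<and> (\<forall>xs\<in>Q. set xs \<notin> vertices ` pick ` isolated_C4s)"
  proof (rule cycle_cover_avoiding)
    show "finite (pick ` isolated_C4s)" using \<open>finite isolated_C4s\<close> by simp
    show "is_C4 t" if "t \<in> pick ` isolated_C4s" for t using that pick by blast
    fix t t' assume t: "t \<in> pick ` isolated_C4s" "t' \<in> pick ` isolated_C4s" "t \<noteq> t'"
    then obtain C C' where C: "C \<in> isolated_C4s" "C' \<in> isolated_C4s" "t = pick C" "t' = pick C'" by blast
    then have "C' \<noteq> C" using t(3) by blast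
    then have "C \<inter> C' = {}" using C(1,2) unfolding isolated_C4s_def by blast
    then show "vertices t \<inter> vertices t' = {}" using pick C by simp
  qed
  moreover have "vertices ` pick ` isolated_C4s = isolated_C4s"
    using pick by (force simp: image_iff)
  ultimately show ?thesis by simp
qed

lemma cycle_cover_no_C4: "\<exists>Q. cycle_cover E (A \<union> B) Q \<and> (\<forall>xs\<in>Q. length xs \<noteq> 4)"
proof -
  define ok where "ok Q \<longleftrightarrow> cycle_cover E (A \<union> B) Q \<and> (\<forall>xs\<in>Q. set xs \<notin> isolated_C4s)" for Q
  obtain Q where okQ: "ok Q" and min: "\<And>Q'. ok Q' \<Longrightarrow> card Q \<le> card Q'"
    using cycle_cover_no_isolated_C4 ex_has_least_nat[of ok _ card] unfolding ok_def[symmetric] by metis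
  have Q: "cycle_cover E (A \<union> B) Q" "\<And>xs. xs \<in> Q \<Longrightarrow> set xs \<notin> isolated_C4s"
    using okQ by (auto simp: ok_def)
  have "length xs \<noteq> 4" if xs: "xs \<in> Q" for xs
  proof
    assume len: "length xs = 4"
    have cyc: "cycle E xs" using Q xs by (simp add: cycle_cover_def)
    obtain t where t: "is_C4 t" "set xs = vertices t" using cycle_of_length_4[OF cyc len] .
    have "set xs \<notin> isolated_C4s" using Q(2)[OF xs] .
    then obtain t' where t': "is_C4 t'" "vertices t' \<noteq> set xs" "vertices t' \<inter> set xs \<noteq> {}"
      using t unfolding isolated_C4s_def by blast
    \<comment> \<open>Both vertex sets have four elements, so being different means that
      \<open>t'\<close> is not contained in \<open>set xs\<close>.\<close>
    have "card (set xs) = 4" using cyc len by (simp add: cycle_def distinct_card)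
    moreover have "card (vertices t') = 4"
    proof -
      obtain p q r s where "t' = (p, q, r, s)" by (cases t')
      then show ?thesis using t'(1) disjoint by (auto simp: is_C4_iff vertices_def card_insert_if)
    qed
    ultimately have "\<not> vertices t' \<subseteq> set xs"
      using t'(2) card_subset_eq[of "set xs" "vertices t'"] by auto
    then obtain v1 v2 v3 v4 where v: "v1 \<in> A \<union> B" "v1 \<notin> set xs" "v2 \<in> set xs"
      "E v1 v2" "E v2 v3" "E v3 v4" "E v4 v1" "v1 \<noteq> v3" "v2 \<noteq> v4"
      using C4_leaving_set[OF t'(1) _ t'(3)] by blast
    obtain zs Q' where Q': "zs \<in> Q'" "Q' - {zs} \<subseteq> Q" "cycle_cover E (A \<union> B) Q'" "card Q' < card Q"
      "length zs > length xs"
      using cycle_cover_merge[OF Q(1) sym degree3 xs v] .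
    \<comment> \<open>The merged cycle has more than four vertices, and all other cycles of
      \<open>Q'\<close> come from \<open>Q\<close>. Thus \<open>Q'\<close> is again admissible but
      has fewer cycles, contradicting minimality.\<close>
    have "set zs \<notin> isolated_C4s"
    proof
      assume "set zs \<in> isolated_C4s"
      then obtain p q r s where "set zs = {p, q, r, s}"
        by (auto simp: isolated_C4s_def vertices_def)
      then have "card (set zs) \<le> 4" using card_length[of "[p, q, r, s]"] by simp
      moreover have "distinct zs" using Q'(1,3) by (simp add: cycle_cover_def cycle_def)
      ultimately show False using Q'(5) len by (simp add: distinct_card)
    qed
    then have "ok Q'" unfolding ok_def using Q(2) Q'(2,3) by blast
    then show False using min Q'(4) by force
  qed
  then show ?thesis using Q(1) by blast
qed

end

theorem mainTheorem4:
  fixes V :: "'a set" and E :: "'a \<Rightarrow> 'a \<Rightarrow> bool" and n :: nat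
  assumes "simple_graph V E" and "connected_graph V E" and "bipartite V E"
    and "cubic V E" and "card V = n"
  shows "has_IPD V E \<and> 3 * rho V E \<le> n"
proof -
  obtain A B where AB: "A \<union> B = V" "A \<inter> B = {}"
    and edge: "\<And>u v. E u v \<Longrightarrow> (u \<in> A \<and> v \<in> B) \<or> (u \<in> B \<and> v \<in> A)"
    using assms(3) unfolding bipartite_def by blast
  have deg: "card {u. E v u} = 3" if "v \<in> V" for v
  proof -
    have "{u. E v u} = {u \<in> V. E v u}" using assms(1) by (auto simp: simple_graph_def)
    then show ?thesis using assms(4) that by (simp add: cubic_def degree_def)
  qed
  have fin: "finite V" and sym: "symp E" using assms(1) by (auto simp: simple_graph_def intro: sympI)
  interpret bipartite_cubic_graph A B E
    using fin AB edge sym deg by unfold_locales auto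
  obtain Q where Q: "cycle_cover E V Q" "\<forall>xs\<in>Q. length xs \<noteq> 4"
    using cycle_cover_no_C4 AB by blast
  have "third_IPD E V"
    by (rule cycle_cover_third_IPD[OF Q(1) sym, of A]) (use edge AB deg Q in blast)+
  then obtain P where P: "is_IPD V E P" "3 * card P \<le> card V" by (auto simp: third_IPD_def)
  have "rho V E \<le> card P" unfolding rho_def by (rule Least_le) (use P in blast)
  then show ?thesis using P assms(5) by (auto simp: has_IPD_def)
qed

end
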